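(* Let $d\ge 1$ and let $\mathcal{X}_1,\ldots,\mathcal{X}_d$ be free symmetric collections of finite sets with $\mathcal{X}_k(\underline{0})=\mathcal{X}_k(\underline{1})=\varnothing$ for all $1\le k\le d$. Then for every $n\ge 1$ the underlying $S_n$-module of $(\mathcal{T}(\mathcal{X}_1)\otimes\cdots\otimes\mathcal{T}(\mathcal{X}_d))(\underline{n})$ is free, i.e. $S_n$ acts freely on this set.
   Context: A symmetric collection of finite sets is a contravariant functor from the groupoid of nonempty finite sets and bijections to finite sets; $\underline{n}=\{1,\ldots,n\}$; it is free if each $S_n$ acts freely on its value at $\underline{n}$. $\mathcal{T}(\mathcal{X})$ is the free symmetric operad generated by $\mathcal{X}$; $\gamma$ denotes operadic composition. The Boardman--Vogt tensor product $\mathcal{P}\otimes\mathcal{Q}$ of set operads is the quotient of the coproduct $\mathcal{P}\sqcup\mathcal{Q}$ by the operadic congruence generated by the interchange relations $\gamma(p;q,\ldots,q)=\gamma(q;p,\ldots,p).\sigma_{k,l}$ for $p\in\mathcal{P}(\underline{k})$, $q\in\mathcal{Q}(\underline{l})$, where $\sigma_{k,l}((i-1)l+j)=(j-1)k+i$ for $1\le i\le k$, $1\le j\le l$; that is, $p(q(x_{11},\ldots,x_{1l}),\ldots,q(x_{k1},\ldots,x_{kl}))=q(p(x_{11},\ldots,x_{k1}),\ldots,p(x_{1l},\ldots,x_{kl}))$. The $d$-fold product is obtained by iteration. *)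

theory Defs
  imports "HOL-Combinatorics.Permutations"
begin

section \<open>Symmetric collections\<close>

text \<open>
  A contravariant functor on the groupoid of finite sets and bijections is given on the finite
  sets of natural numbers (an equivalent groupoid). For a bijection \<open>f\<close> from \<open>A\<close> to \<open>B\<close>,
  \<open>pull X A B f\<close> is the map from \<open>elems X B\<close> to \<open>elems X A\<close>. The set written \<open>n\<close> underlined
  is \<open>{1..n}\<close>, and \<open>pull X {1..n} {1..n} \<sigma> x\<close> is the right action \<open>x.\<sigma>\<close> of the symmetric group.
\<close>

record 'a collection =
  elems :: "nat set \<Rightarrow> 'a set"
  pull :: "nat set \<Rightarrow> nat set \<Rightarrow> (nat \<Rightarrow> nat) \<Rightarrow> 'a \<Rightarrow> 'a"

text \<open>
  A bijection from \<open>A\<close> to \<open>B\<close> is represented by any function that restricts to it, hence the last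
  clause.
\<close>

definition symmetric_collection :: "('a, 'm) collection_scheme \<Rightarrow> bool" where
  "symmetric_collection X \<longleftrightarrow>
     (\<forall>A. finite A \<and> A \<noteq> {} \<longrightarrow> finite (elems X A)) \<and>
     (\<forall>A B f. finite A \<and> A \<noteq> {} \<and> bij_betw f A B \<longrightarrow>
        (\<forall>x\<in>elems X B. pull X A B f x \<in> elems X A)) \<and>
     (\<forall>A. finite A \<and> A \<noteq> {} \<longrightarrow> (\<forall>x\<in>elems X A. pull X A A id x = x)) \<and>
     (\<forall>A B C f g. finite A \<and> A \<noteq> {} \<and> bij_betw f A B \<and> bij_betw g B C \<longrightarrow>
        (\<forall>x\<in>elems X C. pull X A C (g \<circ> f) x = pull X A B f (pull X B C g x))) \<and>
     (\<forall>A B f g. finite A \<and> A \<noteq> {} \<and> bij_betw f A B \<and> (\<forall>a\<in>A. f a = g a) \<longrightarrow>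
        (\<forall>x\<in>elems X B. pull X A B f x = pull X A B g x))"

definition acts_freely :: "('a, 'm) collection_scheme \<Rightarrow> nat \<Rightarrow> bool" where
  "acts_freely X n \<longleftrightarrow>
     (\<forall>x\<in>elems X {1..n}. \<forall>\<sigma>. \<sigma> permutes {1..n} \<longrightarrow>
        pull X {1..n} {1..n} \<sigma> x = x \<longrightarrow> \<sigma> = id)"

definition free_collection :: "('a, 'm) collection_scheme \<Rightarrow> bool" where
  "free_collection X \<longleftrightarrow> (\<forall>n\<ge>1. acts_freely X n)"

definition coproduct_collection ::
  "('a, 'm) collection_scheme \<Rightarrow> ('b, 'n) collection_scheme \<Rightarrow> ('a + 'b) collection" where
  "coproduct_collection X Y =
     \<lparr>elems = (\<lambda>A. elems X A <+> elems Y A),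
      pull = (\<lambda>A B f. map_sum (pull X A B f) (pull Y A B f))\<rparr>"


section \<open>Operads and operadic congruences\<close>

text \<open>
  \<open>comp P p [n\<^sub>1, \<dots>, n\<^sub>k] [q\<^sub>1, \<dots>, q\<^sub>k]\<close> is \<open>\<gamma>(p; q\<^sub>1, \<dots>, q\<^sub>k)\<close> for \<open>p\<close> in \<open>P({1..k})\<close>
  and \<open>q\<^sub>i\<close> in \<open>P({1..n\<^sub>i})\<close>; it lies in \<open>P({1..n\<^sub>1+\<dots>+n\<^sub>k})\<close>. The arities are passed
  explicitly because the sets \<open>P({1..n})\<close> need not be disjoint. Only the structure on the
  elements of the operad is relevant; outside of it the operations take arbitrary values.
\<close>

record 'a operad = "'a collection" +
  one :: 'a
  comp :: "'a \<Rightarrow> nat list \<Rightarrow> 'a list \<Rightarrow> 'a"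

text \<open>The operadic congruence generated by relations \<open>R n\<close> on \<open>P({1..n})\<close>.\<close>

inductive congruence :: "'a operad \<Rightarrow> (nat \<Rightarrow> 'a \<Rightarrow> 'a \<Rightarrow> bool) \<Rightarrow> nat set \<Rightarrow> 'a \<Rightarrow> 'a \<Rightarrow> bool"
  for P R where
  generator: "R n x y \<Longrightarrow> x \<in> elems P {1..n} \<Longrightarrow> y \<in> elems P {1..n} \<Longrightarrow> congruence P R {1..n} x y"
| refl: "x \<in> elems P A \<Longrightarrow> congruence P R A x x"
| sym: "congruence P R A x y \<Longrightarrow> congruence P R A y x"
| trans: "congruence P R A x y \<Longrightarrow> congruence P R A y z \<Longrightarrow> congruence P R A x z"
| pull: "finite A \<Longrightarrow> A \<noteq> {} \<Longrightarrow> bij_betw f A B \<Longrightarrow> congruence P R B x y \<Longrightarrow>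
    congruence P R A (pull P A B f x) (pull P A B f y)"
| comp: "length qs = length ns \<Longrightarrow> length qs' = length ns \<Longrightarrow>
    congruence P R {1..length ns} p p' \<Longrightarrow>
    (\<And>i. i < length ns \<Longrightarrow> congruence P R {1..ns ! i} (qs ! i) (qs' ! i)) \<Longrightarrow>
    congruence P R {1..sum_list ns} (comp P p ns qs) (comp P p' ns qs')"

definition congruence_class ::
  "'a operad \<Rightarrow> (nat \<Rightarrow> 'a \<Rightarrow> 'a \<Rightarrow> bool) \<Rightarrow> nat set \<Rightarrow> 'a \<Rightarrow> 'a set" where
  "congruence_class P R A x = {y \<in> elems P A. congruence P R A x y}"

definition rep :: "'a set \<Rightarrow> 'a" where
  "rep C = (SOME x. x \<in> C)"

definition quotient_operad ::
  "'a operad \<Rightarrow> (nat \<Rightarrow> 'a \<Rightarrow> 'a \<Rightarrow> bool) \<Rightarrow> 'a set operad" where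
  "quotient_operad P R =
     \<lparr>elems = (\<lambda>A. congruence_class P R A ` elems P A),
      pull = (\<lambda>A B f C. congruence_class P R A (pull P A B f (rep C))),
      one = congruence_class P R {1} (one P),
      comp = (\<lambda>C ns Ds. congruence_class P R {1..sum_list ns} (comp P (rep C) ns (map rep Ds)))\<rparr>"


section \<open>Free operads\<close>

datatype 'x tree = Leaf nat | Node 'x "'x tree list"

primrec leaves :: "'x tree \<Rightarrow> nat list" where
  "leaves (Leaf i) = [i]"
| "leaves (Node x ts) = concat (map leaves ts)"

primrec subst_leaves :: "(nat \<Rightarrow> 'x tree) \<Rightarrow> 'x tree \<Rightarrow> 'x tree" where
  "subst_leaves s (Leaf i) = s i"
| "subst_leaves s (Node x ts) = Node x (map (subst_leaves s) ts)"

abbreviation relabel :: "(nat \<Rightarrow> nat) \<Rightarrow> 'x tree \<Rightarrow> 'x tree" where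
  "relabel f \<equiv> subst_leaves (\<lambda>i. Leaf (f i))"

fun decorated :: "('x, 'm) collection_scheme \<Rightarrow> 'x tree \<Rightarrow> bool" where
  "decorated X (Leaf i) \<longleftrightarrow> True"
| "decorated X (Node x ts) \<longleftrightarrow> x \<in> elems X {1..length ts} \<and> (\<forall>t\<in>set ts. decorated X t)"

text \<open>
  Planar rooted trees whose leaves are labelled bijectively by the elements of \<open>A\<close> and whose
  vertices with \<open>k\<close> inputs carry an element of \<open>X({1..k})\<close>. Substituting \<open>q\<^sub>i\<close> for the leaf \<open>i\<close>
  shifts the labels of \<open>q\<^sub>i\<close> by \<open>n\<^sub>1+\<dots>+n\<^sub>i\<^sub>-\<^sub>1\<close>. This operad does not yet take into account the
  action of the symmetric groups on \<open>X\<close>.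
\<close>

definition tree_operad :: "('x, 'm) collection_scheme \<Rightarrow> 'x tree operad" where
  "tree_operad X =
     \<lparr>elems = (\<lambda>A. {t. decorated X t \<and> distinct (leaves t) \<and> set (leaves t) = A}),
      pull = (\<lambda>A B f. relabel (inv_into A f)),
      one = Leaf 1,
      comp = (\<lambda>t ns us.
        subst_leaves (\<lambda>i. relabel (\<lambda>j. sum_list (take (i - 1) ns) + j) (us ! (i - 1))) t)\<rparr>"

definition corolla :: "nat \<Rightarrow> 'x \<Rightarrow> 'x tree" where
  "corolla n x = Node x (map Leaf [1..<n + 1])"

inductive equivariance :: "('x, 'm) collection_scheme \<Rightarrow> nat \<Rightarrow> 'x tree \<Rightarrow> 'x tree \<Rightarrow> bool" for X where
  "x \<in> elems X {1..n} \<Longrightarrow> \<sigma> permutes {1..n} \<Longrightarrow>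
    equivariance X n (corolla n (pull X {1..n} {1..n} \<sigma> x))
      (pull (tree_operad X) {1..n} {1..n} \<sigma> (corolla n x))"

definition free_operad :: "('x, 'm) collection_scheme \<Rightarrow> 'x tree set operad" where
  "free_operad X = quotient_operad (tree_operad X) (equivariance X)"

definition free_gen :: "('x, 'm) collection_scheme \<Rightarrow> nat \<Rightarrow> 'x \<Rightarrow> 'x tree set" where
  "free_gen X n x = congruence_class (tree_operad X) (equivariance X) {1..n} (corolla n x)"


section \<open>Coproducts and the Boardman--Vogt tensor product\<close>

text \<open>
  The coproduct is the quotient of the free operad on the disjoint union of the underlying
  collections by the relations that make both inclusions morphisms of operads (compatibility with
  the symmetric groups already holds in the free operad).
\<close>

abbreviation pregen_left :: "'a operad \<Rightarrow> 'b operad \<Rightarrow> nat \<Rightarrow> 'a \<Rightarrow> ('a + 'b) tree set" where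
  "pregen_left P Q n p \<equiv> free_gen (coproduct_collection P Q) n (Inl p)"

abbreviation pregen_right :: "'a operad \<Rightarrow> 'b operad \<Rightarrow> nat \<Rightarrow> 'b \<Rightarrow> ('a + 'b) tree set" where
  "pregen_right P Q n q \<equiv> free_gen (coproduct_collection P Q) n (Inr q)"

inductive coproduct_relation ::
  "'a operad \<Rightarrow> 'b operad \<Rightarrow> nat \<Rightarrow> ('a + 'b) tree set \<Rightarrow> ('a + 'b) tree set \<Rightarrow> bool" for P Q where
  one_left: "coproduct_relation P Q 1
    (pregen_left P Q 1 (one P)) (one (free_operad (coproduct_collection P Q)))"
| one_right: "coproduct_relation P Q 1
    (pregen_right P Q 1 (one Q)) (one (free_operad (coproduct_collection P Q)))"
| comp_left: "p \<in> elems P {1..length ns} \<Longrightarrow> length ps = length ns \<Longrightarrow>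
    (\<And>i. i < length ns \<Longrightarrow> ps ! i \<in> elems P {1..ns ! i}) \<Longrightarrow>
    coproduct_relation P Q (sum_list ns)
      (pregen_left P Q (sum_list ns) (comp P p ns ps))
      (comp (free_operad (coproduct_collection P Q))
        (pregen_left P Q (length ns) p) ns (map2 (pregen_left P Q) ns ps))"
| comp_right: "q \<in> elems Q {1..length ns} \<Longrightarrow> length qs = length ns \<Longrightarrow>
    (\<And>i. i < length ns \<Longrightarrow> qs ! i \<in> elems Q {1..ns ! i}) \<Longrightarrow>
    coproduct_relation P Q (sum_list ns)
      (pregen_right P Q (sum_list ns) (comp Q q ns qs))
      (comp (free_operad (coproduct_collection P Q))
        (pregen_right P Q (length ns) q) ns (map2 (pregen_right P Q) ns qs))"

definition coproduct_operad :: "'a operad \<Rightarrow> 'b operad \<Rightarrow> ('a + 'b) tree set set operad" where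
  "coproduct_operad P Q =
     quotient_operad (free_operad (coproduct_collection P Q)) (coproduct_relation P Q)"

definition inj_left :: "'a operad \<Rightarrow> 'b operad \<Rightarrow> nat \<Rightarrow> 'a \<Rightarrow> ('a + 'b) tree set set" where
  "inj_left P Q n p = congruence_class (free_operad (coproduct_collection P Q))
     (coproduct_relation P Q) {1..n} (pregen_left P Q n p)"

definition inj_right :: "'a operad \<Rightarrow> 'b operad \<Rightarrow> nat \<Rightarrow> 'b \<Rightarrow> ('a + 'b) tree set set" where
  "inj_right P Q n q = congruence_class (free_operad (coproduct_collection P Q))
     (coproduct_relation P Q) {1..n} (pregen_right P Q n q)"

definition interchange_perm :: "nat \<Rightarrow> nat \<Rightarrow> nat \<Rightarrow> nat" where
  "interchange_perm k l m =
     (if m \<in> {1..k * l} then ((m - 1) mod l) * k + (m - 1) div l + 1 else m)"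

lemma interchange_perm_eq:
  assumes "i \<in> {1..k}" "j \<in> {1..l}"
  shows "interchange_perm k l ((i - 1) * l + j) = (j - 1) * k + i"
proof -
  obtain a b where ab: "i = Suc a" "j = Suc b" "a < k" "b < l"
    using assms by (metis Suc_le_lessD Suc_pred' atLeastAtMost_iff One_nat_def less_eq_Suc_le)
  have "a * l + b < Suc a * l" using ab by simp
  also have "\<dots> \<le> k * l" using ab by (intro mult_right_mono) auto
  finally have "a * l + b < k * l" .
  then show ?thesis using ab by (simp add: interchange_perm_def)
qed

inductive interchange ::
  "'a operad \<Rightarrow> 'b operad \<Rightarrow> nat \<Rightarrow> ('a + 'b) tree set set \<Rightarrow> ('a + 'b) tree set set \<Rightarrow> bool"
  for P Q where
  "p \<in> elems P {1..k} \<Longrightarrow> q \<in> elems Q {1..l} \<Longrightarrow>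
    interchange P Q (k * l)
      (comp (coproduct_operad P Q)
        (inj_left P Q k p) (replicate k l) (replicate k (inj_right P Q l q)))
      (pull (coproduct_operad P Q) {1..k * l} {1..k * l} (interchange_perm k l)
        (comp (coproduct_operad P Q)
          (inj_right P Q l q) (replicate l k) (replicate l (inj_left P Q k p))))"

definition BV_tensor :: "'a operad \<Rightarrow> 'b operad \<Rightarrow> ('a + 'b) tree set set set operad" where
  "BV_tensor P Q = quotient_operad (coproduct_operad P Q) (interchange P Q)"


section \<open>Iterated tensor products\<close>

text \<open>
  The type of elements grows with every tensor product. To iterate a variable number of times, each
  stage is replaced by an isomorphic copy with elements in a fixed type: structure is transported
  along an encoding that is injective on elements (lemma \<open>inj_on_encode\<close>).
\<close>

definition transport :: "('a \<Rightarrow> 'b) \<Rightarrow> 'a operad \<Rightarrow> 'b operad" where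
  "transport e P =
     \<lparr>elems = (\<lambda>A. e ` elems P A),
      pull = (\<lambda>A B f y. e (pull P A B f (inv_into (elems P B) e y))),
      one = e (one P),
      comp = (\<lambda>y ns zs. e (comp P (inv_into (elems P {1..length ns}) e y) ns
        (map2 (\<lambda>n. inv_into (elems P {1..n}) e) ns zs)))\<rparr>"

datatype 'g universe = Base 'g | Tensor "('g universe + 'g universe) tree"

definition encode :: "('g universe + 'g universe) tree set set set \<Rightarrow> 'g universe" where
  "encode C = Tensor (rep (rep (rep C)))"

lemma quotient_operad_rep:
  assumes "C \<in> elems (quotient_operad P R) A"
  shows "rep C \<in> elems P A" "C = congruence_class P R A (rep C)"
proof -
  from assms obtain x where x: "x \<in> elems P A" "C = congruence_class P R A x"
    by (auto simp: quotient_operad_def)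
  then have "x \<in> C" by (auto simp: congruence_class_def intro: congruence.refl)
  then have "rep C \<in> C" unfolding rep_def by (rule someI)
  then have *: "rep C \<in> elems P A" "congruence P R A x (rep C)"
    using x by (auto simp: congruence_class_def)
  then show "rep C \<in> elems P A" by simp
  show "C = congruence_class P R A (rep C)"
    using x * by (auto simp: congruence_class_def intro: congruence.trans congruence.sym)
qed

lemma inj_on_encode: "inj_on encode (elems (BV_tensor P Q) A)"
proof (rule inj_onI)
  fix C D
  assume C: "C \<in> elems (BV_tensor P Q) A" and D: "D \<in> elems (BV_tensor P Q) A"
    and eq: "encode C = encode D"
  note C1 = quotient_operad_rep[OF C[unfolded BV_tensor_def]]
  note D1 = quotient_operad_rep[OF D[unfolded BV_tensor_def]]
  note C2 = quotient_operad_rep[OF C1(1)[unfolded coproduct_operad_def]]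
  note D2 = quotient_operad_rep[OF D1(1)[unfolded coproduct_operad_def]]
  note C3 = quotient_operad_rep[OF C2(1)[unfolded free_operad_def]]
  note D3 = quotient_operad_rep[OF D2(1)[unfolded free_operad_def]]
  have "rep (rep (rep C)) = rep (rep (rep D))" using eq by (simp add: encode_def)
  then have "rep (rep C) = rep (rep D)" using C3(2) D3(2) by metis
  then have "rep C = rep D" using C2(2) D2(2) by metis
  then show "C = D" using C1(2) D1(2) by metis
qed

text \<open>\<open>((P 1 \<otimes> P 2) \<otimes> \<dots>) \<otimes> P d\<close> for \<open>d \<ge> 1\<close>.\<close>

definition iterated_BV_tensor :: "nat \<Rightarrow> (nat \<Rightarrow> 'g operad) \<Rightarrow> 'g universe operad" where
  "iterated_BV_tensor d P =
     foldl (\<lambda>T k. transport encode (BV_tensor T (transport Base (P k))))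
       (transport Base (P 1)) [2..<d + 1]"

end

theory Submission
  imports Defs "HOL-Library.Sublist"
begin

text \<open>
  A set with an equivariant map to a free \<open>S\<^sub>n\<close>-set is free, so it suffices to map the tensor product
  to an operad with free actions. The target is a discrete version of the little cubes operad: a
  cube is a family of words, the word in direction \<open>k\<close> recording successive subdivisions in that
  direction; a configuration places pairwise disjoint cubes at the inputs, and cubes are composed by
  concatenating words in every direction. Since \<open>X\<^sub>k\<close> is free, each of its elements is uniquely
  \<open>r.\<sigma>\<close> with \<open>r\<close> a chosen representative of the orbit; it is sent to the subdivision in direction \<open>k\<close>
  whose \<open>a\<close>-th input is the piece \<open>\<sigma> a\<close>. The interchange relations hold because subdivisions in
  different directions commute.
\<close>

declare One_nat_def [simp del]

section \<open>Cubes\<close>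

type_synonym cube = "nat \<Rightarrow> nat list"

text \<open>\<open>u \<odot> v\<close> stands for the cube \<open>v\<close> rescaled into
  \<open>u\<close>. The empty word leaves a direction undivided, so the family of empty words is the
  whole cube and the unit.\<close>

definition subcube :: "cube \<Rightarrow> cube \<Rightarrow> cube" (infixr "\<odot>" 65) where
  "u \<odot> v = (\<lambda>k. u k @ v k)"

text \<open>Words name nested intervals, so two intervals are disjoint exactly when neither word is
  a prefix of the other; boxes are disjoint as soon as one direction separates them.\<close>

definition apart :: "cube \<Rightarrow> cube \<Rightarrow> bool" where
  "apart u v \<longleftrightarrow> (\<exists>k. u k \<parallel> v k)"

lemma subcube_assoc: "(u \<odot> v) \<odot> w = u \<odot> (v \<odot> w)"
  by (simp add: subcube_def)

lemma subcube_unit [simp]: "(\<lambda>_. []) \<odot> u = u" "u \<odot> (\<lambda>_. []) = u"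
  by (simp_all add: subcube_def)

lemma not_apart_self: "\<not> apart u u"
  by (auto simp: apart_def)

text \<open>Shrinking two disjoint cubes keeps them disjoint: prefix-incomparable words stay
  incomparable under arbitrary extensions.\<close>

lemma apart_subcube: "apart u v \<Longrightarrow> apart (u \<odot> u') (v \<odot> v')"
  unfolding apart_def subcube_def by (blast intro: parallel_append)

lemma apart_subcube_same: "apart u v \<Longrightarrow> apart (w \<odot> u) (w \<odot> v)"
  by (auto simp: apart_def subcube_def parallel_def)

text \<open>In every direction at least one of the two words is empty, so the order of concatenation
  is immaterial. This is the source of the interchange relations.\<close>

lemma subcube_commute:
  assumes "\<And>k. k \<notin> D \<Longrightarrow> u k = []" "\<And>k. k \<notin> E \<Longrightarrow> v k = []" "D \<inter> E = {}"
  shows "u \<odot> v = v \<odot> u"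
proof
  fix k
  show "(u \<odot> v) k = (v \<odot> u) k"
  proof (cases "k \<in> D")
    case True
    then have "v k = []" using assms(2,3) by blast
    then show ?thesis by (simp add: subcube_def)
  next
    case False
    then show ?thesis using assms(1) by (simp add: subcube_def)
  qed
qed

section \<open>Consecutive blocks\<close>

text \<open>Blocks correspond to the inputs of an operadic composite. The block index
  \<open>i\<close> counts from 0 like a list position and \<open>j\<close> counts from 1 like a
  label, whence \<open>Suc i\<close> in \<open>place_comp\<close>.\<close>

lemma block_exists:
  fixes ns :: "nat list"
  assumes "a \<in> {1..sum_list ns}"
  obtains i j where "i < length ns" "j \<in> {1..ns ! i}" "a = sum_list (take i ns) + j"
proof -
  have "\<exists>i j. i < length ns \<and> j \<in> {1..ns ! i} \<and> a = sum_list (take i ns) + j"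
    using assms
  proof (induction ns arbitrary: a)
    case (Cons m ns)
    show ?case
    proof (cases "a \<le> m")
      case True
      then show ?thesis using Cons.prems by (intro exI[of _ 0] exI[of _ a]) auto
    next
      case False
      then have "a - m \<in> {1..sum_list ns}" using Cons.prems by auto
      from Cons.IH[OF this] obtain i j where
        "i < length ns" "j \<in> {1..ns ! i}" "a - m = sum_list (take i ns) + j" by blast
      then show ?thesis using False by (intro exI[of _ "Suc i"] exI[of _ j]) auto
    qed
  qed simp
  then show ?thesis using that by blast
qed

lemma grid_exists:
  fixes k l m :: nat
  assumes "m \<in> {1..k * l}"
  obtains i j where "i < k" "j \<in> {1..l}" "m = i * l + j"
proof -
  have "m \<in> {1..sum_list (replicate k l)}" using assms by (simp add: sum_list_replicate)
  then obtain i j where ij: "i < length (replicate k l)" "j \<in> {1..replicate k l ! i}"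
    "m = sum_list (take i (replicate k l)) + j"
    by (rule block_exists)
  then show ?thesis by (intro that[of i j]) (simp_all add: sum_list_replicate)
qed

lemma sum_list_take_mono: "i \<le> k \<Longrightarrow> sum_list (take i ns) \<le> sum_list (take k (ns :: nat list))"
  by (metis le_add1 le_add_diff_inverse sum_list_append take_add)

lemma block_end:
  fixes ns :: "nat list"
  assumes "i < length ns" "j \<le> ns ! i" "i < k"
  shows "sum_list (take i ns) + j \<le> sum_list (take k ns)"
proof -
  have "sum_list (take i ns) + j \<le> sum_list (take (Suc i) ns)"
    using assms by (simp add: take_Suc_conv_app_nth)
  also have "\<dots> \<le> sum_list (take k ns)" using assms by (intro sum_list_take_mono) simp
  finally show ?thesis .
qed

lemma block_mem:
  fixes ns :: "nat list"
  assumes "i < length ns" "j \<in> {1..ns ! i}"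
  shows "sum_list (take i ns) + j \<in> {1..sum_list ns}"
  using assms block_end[of i ns j "length ns"] by auto

text \<open>If \<open>i < i'\<close>, then \<open>block_end\<close> puts the left-hand position no
  later than the end of block \<open>i\<close>, while \<open>j' \<ge> 1\<close> puts the right-hand
  one strictly beyond it.\<close>

lemma block_unique:
  fixes ns :: "nat list"
  assumes "i < length ns" "j \<in> {1..ns ! i}" "i' < length ns" "j' \<in> {1..ns ! i'}"
    and eq: "sum_list (take i ns) + j = sum_list (take i' ns) + j'"
  shows "i = i'"
proof (rule ccontr)
  assume "i \<noteq> i'"
  then consider "i < i'" | "i' < i" by linarith
  then show False
    using block_end[of i ns j i'] block_end[of i' ns j' i] assms by cases auto
qed

section \<open>Placements\<close>

text \<open>
  A morphism from \<open>P\<close> to the operad of cube configurations subdivided in the directions \<open>D\<close> only: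
  \<open>h A x a\<close> is the cube at the input \<open>a\<close> of \<open>x\<close> in \<open>P(A)\<close>.
\<close>

locale placement =
  fixes D :: "nat set" and P :: "'a operad" and h :: "nat set \<Rightarrow> 'a \<Rightarrow> nat \<Rightarrow> cube"
  assumes pull_closed: "\<And>A B f x. finite A \<Longrightarrow> A \<noteq> {} \<Longrightarrow> bij_betw f A B \<Longrightarrow> x \<in> elems P B \<Longrightarrow>
      pull P A B f x \<in> elems P A"
    and place_pull: "\<And>A B f x a. finite A \<Longrightarrow> A \<noteq> {} \<Longrightarrow> bij_betw f A B \<Longrightarrow> x \<in> elems P B \<Longrightarrow>
      a \<in> A \<Longrightarrow> h A (pull P A B f x) a = h B x (f a)"
    and one_closed: "one P \<in> elems P {1}"
    and place_one: "h {1} (one P) 1 = (\<lambda>_. [])"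
    and comp_closed: "\<And>p ns qs. length qs = length ns \<Longrightarrow> p \<in> elems P {1..length ns} \<Longrightarrow>
      (\<And>i. i < length ns \<Longrightarrow> qs ! i \<in> elems P {1..ns ! i}) \<Longrightarrow>
      comp P p ns qs \<in> elems P {1..sum_list ns}"
    and place_comp: "\<And>p ns qs i j. length qs = length ns \<Longrightarrow> p \<in> elems P {1..length ns} \<Longrightarrow>
      (\<And>i. i < length ns \<Longrightarrow> qs ! i \<in> elems P {1..ns ! i}) \<Longrightarrow>
      i < length ns \<Longrightarrow> j \<in> {1..ns ! i} \<Longrightarrow>
      h {1..sum_list ns} (comp P p ns qs) (sum_list (take i ns) + j)
        = h {1..length ns} p (Suc i) \<odot> h {1..ns ! i} (qs ! i) j"
    and support: "\<And>A x a k. x \<in> elems P A \<Longrightarrow> a \<in> A \<Longrightarrow> k \<notin> D \<Longrightarrow> h A x a k = []"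
    and apart: "\<And>A x a b. x \<in> elems P A \<Longrightarrow> a \<in> A \<Longrightarrow> b \<in> A \<Longrightarrow> a \<noteq> b \<Longrightarrow>
      apart (h A x a) (h A x b)"
begin

text \<open>If \<open>\<sigma>\<close> fixes \<open>x\<close>, the inputs \<open>a\<close> and
  \<open>\<sigma> a\<close> of \<open>x\<close> carry the same cube. Distinct inputs carry disjoint
  cubes and no cube is apart from itself, so \<open>\<sigma> a = a\<close>.\<close>

lemma acts_freely:
  assumes "n \<ge> 1"
  shows "acts_freely P n"
  unfolding acts_freely_def
proof (intro ballI allI impI)
  fix x \<sigma>
  assume x: "x \<in> elems P {1..n}" and \<sigma>: "\<sigma> permutes {1..n}"
    and fixed: "pull P {1..n} {1..n} \<sigma> x = x"
  have "\<sigma> a = a" for a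
  proof (cases "a \<in> {1..n}")
    case True
    then have "h {1..n} x a = h {1..n} x (\<sigma> a)"
      using place_pull[OF _ _ permutes_imp_bij[OF \<sigma>] x True] fixed by auto
    moreover have "\<sigma> a \<in> {1..n}" using True \<sigma> by (simp only: permutes_in_image)
    ultimately show ?thesis using apart[OF x True] not_apart_self by metis
  next
    case False
    show ?thesis using \<sigma> False by (rule permutes_not_in)
  qed
  then show "\<sigma> = id" by auto
qed

text \<open>The relations have to lie in the kernel of \<open>h\<close>. Only elements of the operad
  are tested, because the rule \<open>generator\<close> of \<open>congruence\<close> uses
  \<open>R\<close> on these alone.\<close>

definition compatible :: "(nat \<Rightarrow> 'a \<Rightarrow> 'a \<Rightarrow> bool) \<Rightarrow> bool" where
  "compatible R \<longleftrightarrow> (\<forall>n. \<forall>x\<in>elems P {1..n}. \<forall>y\<in>elems P {1..n}. R n x y \<longrightarrow>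
     (\<forall>a\<in>{1..n}. h {1..n} x a = h {1..n} y a))"

text \<open>Having equal placements is preserved by pullback and composition, because
  \<open>h\<close> respects both; the generated congruence therefore stays inside this
  kernel.\<close>

lemma congruence_place:
  assumes R: "compatible R"
    and "congruence P R A x y"
  shows "x \<in> elems P A \<and> y \<in> elems P A \<and> (\<forall>a\<in>A. h A x a = h A y a)"
  using assms(2)
proof induction
  case (generator n x y)
  then show ?case using R unfolding compatible_def by blast
next
  case (pull A f B x y)
  moreover from pull have "f a \<in> B" if "a \<in> A" for a using that by (auto simp: bij_betw_def)
  ultimately show ?case by (auto simp: pull_closed place_pull)
next
  case (comp qs ns qs' p p')
  have "h {1..sum_list ns} (operad.comp P p ns qs) a = h {1..sum_list ns} (operad.comp P p' ns qs') a"
    if "a \<in> {1..sum_list ns}" for a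
  proof -
    from that obtain i j where ij: "i < length ns" "j \<in> {1..ns ! i}" "a = sum_list (take i ns) + j"
      by (rule block_exists)
    have "Suc i \<in> {1..length ns}" using ij by simp
    then show ?thesis using comp ij by (simp add: place_comp)
  qed
  then show ?case using comp by (auto intro!: comp_closed)
qed auto

text \<open>By \<open>congruence_place\<close> the value of \<open>h\<close> on the chosen
  representative does not depend on the choice, so \<open>h\<close> descends to the quotient. The
  second claim serves to evaluate the descended placement on generators.\<close>

lemma quotient_placement:
  assumes R: "compatible R"
  shows "placement D (quotient_operad P R) (\<lambda>A C. h A (rep C))" (is "placement D ?Q ?h")
    and "\<And>A x a. x \<in> elems P A \<Longrightarrow> a \<in> A \<Longrightarrow> h A (rep (congruence_class P R A x)) a = h A x a"
proof -
  have cls: "congruence_class P R A x \<in> elems ?Q A" if "x \<in> elems P A" for A x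
    using that by (simp add: quotient_operad_def)
  have place: "h A (rep (congruence_class P R A x)) a = h A x a"
    if x: "x \<in> elems P A" and a: "a \<in> A" for A x a
  proof -
    have "x \<in> congruence_class P R A x"
      using x by (simp add: congruence_class_def congruence.refl)
    then have "rep (congruence_class P R A x) \<in> congruence_class P R A x"
      unfolding rep_def by (rule someI)
    then have "congruence P R A x (rep (congruence_class P R A x))"
      by (simp add: congruence_class_def)
    then show ?thesis using congruence_place[OF R] a by metis
  qed
  then show "\<And>A x a. x \<in> elems P A \<Longrightarrow> a \<in> A \<Longrightarrow>
      h A (rep (congruence_class P R A x)) a = h A x a" .
  note rep = quotient_operad_rep(1)[of _ P R]
  have pullQ: "pull ?Q A B f C = congruence_class P R A (pull P A B f (rep C))" for A B f C
    by (simp add: quotient_operad_def)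
  have oneQ: "one ?Q = congruence_class P R {1} (one P)"
    by (simp add: quotient_operad_def)
  have compQ: "comp ?Q C ns Ds
      = congruence_class P R {1..sum_list ns} (comp P (rep C) ns (map rep Ds))" for C ns Ds
    by (simp add: quotient_operad_def)
  have comp_rep: "comp P (rep C) ns (map rep Ds) \<in> elems P {1..sum_list ns}"
    if "length Ds = length ns" "C \<in> elems ?Q {1..length ns}"
      "\<And>i. i < length ns \<Longrightarrow> Ds ! i \<in> elems ?Q {1..ns ! i}" for C ns Ds
    using that by (intro comp_closed) (auto intro: rep)
  show "placement D ?Q ?h"
  proof
    fix A B :: "nat set" and f C
    assume A: "finite A" "A \<noteq> {}" "bij_betw f A B" and C: "C \<in> elems ?Q B"
    then show "pull ?Q A B f C \<in> elems ?Q A" by (simp add: pullQ cls pull_closed rep)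
    fix a assume "a \<in> A"
    then show "?h A (pull ?Q A B f C) a = ?h B C (f a)"
      using A C by (simp add: pullQ place pull_closed place_pull rep)
  next
    show "one ?Q \<in> elems ?Q {1}" using cls one_closed by (simp add: oneQ)
    show "?h {1} (one ?Q) 1 = (\<lambda>_. [])"
      using place[OF one_closed] place_one by (simp add: oneQ)
  next
    fix C ns Ds
    assume *: "length Ds = length ns" "C \<in> elems ?Q {1..length ns}"
      "\<And>i. i < length ns \<Longrightarrow> Ds ! i \<in> elems ?Q {1..ns ! i}"
    then show "comp ?Q C ns Ds \<in> elems ?Q {1..sum_list ns}"
      unfolding compQ by (intro cls comp_rep)
    fix i j assume ij: "i < length ns" "j \<in> {1..ns ! i}"
    have "?h {1..sum_list ns} (comp ?Q C ns Ds) (sum_list (take i ns) + j)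
        = h {1..sum_list ns} (comp P (rep C) ns (map rep Ds)) (sum_list (take i ns) + j)"
      unfolding compQ using * ij by (intro place comp_rep block_mem)
    also have "\<dots> = h {1..length ns} (rep C) (Suc i) \<odot> h {1..ns ! i} (map rep Ds ! i) j"
      using * ij by (intro place_comp) (auto intro: rep)
    finally show "?h {1..sum_list ns} (comp ?Q C ns Ds) (sum_list (take i ns) + j)
        = ?h {1..length ns} C (Suc i) \<odot> ?h {1..ns ! i} (Ds ! i) j"
      using * ij by simp
  qed (auto intro: support apart rep)
qed

text \<open>Decoding, then applying \<open>h\<close>, gives the placement. Decoding is done
  separately for each \<open>A\<close>, so injectivity of \<open>e\<close> on each single
  \<open>elems P A\<close> suffices.\<close>

lemma transport_placement:
  assumes inj: "\<And>A. inj_on e (elems P A)"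
  shows "placement D (transport e P) (\<lambda>A y. h A (inv_into (elems P A) e y))"
    (is "placement D ?T ?h")
proof -
  have elemsT: "elems ?T A = e ` elems P A" for A by (simp add: transport_def)
  have pullT: "pull ?T A B f y = e (pull P A B f (inv_into (elems P B) e y))" for A B f y
    by (simp add: transport_def)
  have oneT: "one ?T = e (one P)" by (simp add: transport_def)
  have compT: "comp ?T y ns zs = e (comp P (inv_into (elems P {1..length ns}) e y) ns
      (map2 (\<lambda>n. inv_into (elems P {1..n}) e) ns zs))" for y ns zs
    by (simp add: transport_def)
  have inv_mem: "inv_into (elems P A) e y \<in> elems P A" if "y \<in> elems ?T A" for A y
    using that by (auto simp: elemsT intro: inv_into_into)
  have inv: "inv_into (elems P A) e (e x) = x" if "x \<in> elems P A" for A x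
    using inj that by simp
  show ?thesis
  proof
    fix A B :: "nat set" and f y
    assume A: "finite A" "A \<noteq> {}" "bij_betw f A B" and y: "y \<in> elems ?T B"
    have "pull P A B f (inv_into (elems P B) e y) \<in> elems P A"
      using A inv_mem[OF y] by (rule pull_closed)
    then show "pull ?T A B f y \<in> elems ?T A" by (simp add: pullT elemsT)
    fix a assume "a \<in> A"
    then show "?h A (pull ?T A B f y) a = ?h B y (f a)"
      using A y by (simp add: pullT inv pull_closed place_pull inv_mem)
  next
    show "one ?T \<in> elems ?T {1}" using one_closed by (simp add: oneT elemsT)
    show "?h {1} (one ?T) 1 = (\<lambda>_. [])" using inv[OF one_closed] place_one by (simp add: oneT)
  next
    fix y ns zs
    assume *: "length zs = length ns" "y \<in> elems ?T {1..length ns}"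
      "\<And>i. i < length ns \<Longrightarrow> zs ! i \<in> elems ?T {1..ns ! i}"
    \<comment> \<open>Membership comes first, since \<open>inv_into\<close> is known to undo
      \<open>e\<close> only on \<open>elems P\<close>.\<close>
    have closed: "comp P (inv_into (elems P {1..length ns}) e y) ns
        (map2 (\<lambda>n. inv_into (elems P {1..n}) e) ns zs) \<in> elems P {1..sum_list ns}"
      using * by (intro comp_closed) (auto intro: inv_mem)
    then show "comp ?T y ns zs \<in> elems ?T {1..sum_list ns}" by (simp add: compT elemsT)
    fix i j assume ij: "i < length ns" "j \<in> {1..ns ! i}"
    show "?h {1..sum_list ns} (comp ?T y ns zs) (sum_list (take i ns) + j)
        = ?h {1..length ns} y (Suc i) \<odot> ?h {1..ns ! i} (zs ! i) j"
      unfolding compT inv[OF closed] using * ij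
      by (subst place_comp) (auto intro: inv_mem)
  qed (auto intro: support apart inv_mem)
qed

end

section \<open>Free operads\<close>

text \<open>\<open>g k x i\<close> is the cube attached to the \<open>i\<close>-th input of a vertex with \<open>k\<close> inputs and label \<open>x\<close>.\<close>

inductive leaf_cube :: "(nat \<Rightarrow> 'x \<Rightarrow> nat \<Rightarrow> cube) \<Rightarrow> 'x tree \<Rightarrow> nat \<Rightarrow> cube \<Rightarrow> bool" for g where
  Leaf: "leaf_cube g (Leaf a) a (\<lambda>_. [])"
| Node: "i < length ts \<Longrightarrow> leaf_cube g (ts ! i) a u \<Longrightarrow>
    leaf_cube g (Node x ts) a (g (length ts) x (Suc i) \<odot> u)"

text \<open>A label may occur on several leaves of an arbitrary tree, so the cube is first a
  relation. For elements of the tree operad \<open>leaf_cube_exists\<close> and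
  \<open>leaf_cube_apart\<close> make the description definite.\<close>

definition cube_of :: "(nat \<Rightarrow> 'x \<Rightarrow> nat \<Rightarrow> cube) \<Rightarrow> 'x tree \<Rightarrow> nat \<Rightarrow> cube" where
  "cube_of g t a = (THE u. leaf_cube g t a u)"

section \<open>Leaves and their cubes under substitution\<close>

lemma leaf_cube_leaves: "leaf_cube g t a u \<Longrightarrow> a \<in> set (leaves t)"
  by (induction rule: leaf_cube.induct) (auto intro: nth_mem)

lemma leaf_cube_exists: "a \<in> set (leaves t) \<Longrightarrow> \<exists>u. leaf_cube g t a u"
proof (induction t)
  case (Leaf i)
  then show ?case by (auto intro: leaf_cube.Leaf)
next
  case (Node x ts)
  then obtain t where "t \<in> set ts" "a \<in> set (leaves t)" by auto
  with Node.IH obtain u where "leaf_cube g t a u" by blast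
  with \<open>t \<in> set ts\<close> show ?case by (metis in_set_conv_nth leaf_cube.Node)
qed

text \<open>The path from the root to leaf \<open>b\<close> runs through the former leaf
  \<open>a\<close>; its cube is read off the two segments in turn.\<close>

lemma leaf_cube_subst_leaves:
  "leaf_cube g t a u \<Longrightarrow> leaf_cube g (s a) b v \<Longrightarrow> leaf_cube g (subst_leaves s t) b (u \<odot> v)"
proof (induction rule: leaf_cube.induct)
  case (Node i ts a u x)
  then have "leaf_cube g (map (subst_leaves s) ts ! i) b (u \<odot> v)" by simp
  then show ?case
    using leaf_cube.Node[of i "map (subst_leaves s) ts" g b "u \<odot> v" x] Node.hyps
    by (simp add: subcube_assoc)
qed simp

lemma leaf_cube_relabel: "leaf_cube g t a u \<Longrightarrow> leaf_cube g (relabel f t) (f a) u"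
  using leaf_cube_subst_leaves[of g t a u "\<lambda>i. Leaf (f i)" "f a"] leaf_cube.Leaf by fastforce

lemma leaves_subst_leaves:
  "leaves (subst_leaves s t) = concat (map (\<lambda>a. leaves (s a)) (leaves t))"
proof (induction t)
  case (Node x ts)
  then show ?case by (induction ts) simp_all
qed simp

lemma decorated_subst_leaves:
  "decorated X t \<Longrightarrow> (\<And>a. a \<in> set (leaves t) \<Longrightarrow> decorated X (s a)) \<Longrightarrow>
    decorated X (subst_leaves s t)"
  by (induction t) auto

lemma distinct_concat_map:
  assumes "distinct xs" "\<And>x. x \<in> set xs \<Longrightarrow> distinct (f x)"
    and "\<And>x y. x \<in> set xs \<Longrightarrow> y \<in> set xs \<Longrightarrow> x \<noteq> y \<Longrightarrow> set (f x) \<inter> set (f y) = {}"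
  shows "distinct (concat (map f xs))"
  using assms
proof (induction xs)
  case (Cons x xs)
  then have "set (f x) \<inter> set (f y) = {}" if "y \<in> set xs" for y
    using that by (metis distinct.simps(2) list.set_intros)
  then show ?case using Cons by auto
qed simp

lemma distinct_concat_nth_disjoint:
  assumes "distinct (concat xss)" "i < length xss" "j < length xss" "i \<noteq> j"
  shows "set (xss ! i) \<inter> set (xss ! j) = {}"
proof -
  \<comment> \<open>By symmetry \<open>i < j\<close> is enough: cutting the list at position
    \<open>j\<close> leaves \<open>xss ! i\<close> in the front part.\<close>
  have *: "set (xss ! i) \<inter> set (xss ! j) = {}" if "i < j" "j < length xss" for i j
  proof -
    have "concat xss = concat (take j xss) @ xss ! j @ concat (drop (Suc j) xss)"
      using that by (metis concat.simps(2) concat_append id_take_nth_drop)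
    then have "set (concat (take j xss)) \<inter> set (xss ! j) = {}"
      using assms(1) by auto
    moreover have "xss ! i \<in> set (take j xss)"
      using that by (metis in_set_conv_nth length_take min_less_iff_conj nth_take
          order.strict_trans)
    ultimately show ?thesis by auto
  qed
  show ?thesis using assms *[of i j] *[of j i] by (cases i j rule: linorder_cases) auto
qed

section \<open>Placements of the tree operad and of the free operad\<close>

lemma in_tree_operad:
  "t \<in> elems (tree_operad X) A \<longleftrightarrow> decorated X t \<and> distinct (leaves t) \<and> set (leaves t) = A"
  by (simp add: tree_operad_def)

text \<open>Both directions matter: the forward one recovers membership of \<open>x.\<sigma>\<close>
  in \<open>X\<close> from its corolla in \<open>free_operad_placement\<close>.\<close>

lemma corolla_in_tree_operad:
  "corolla n x \<in> elems (tree_operad X) {1..n} \<longleftrightarrow> x \<in> elems X {1..n}"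
proof -
  have "leaves (corolla n x) = [1..<n + 1]"
    by (simp add: corolla_def o_def concat_map_singleton del: upt_Suc)
  moreover have "set [1..<n + 1] = {1..n}" by auto
  ultimately show ?thesis by (auto simp: in_tree_operad corolla_def)
qed

text \<open>This is an equivariant map from the collection \<open>X\<close> to cube configurations.
  It extends to the free operad on \<open>X\<close> by the universal property, made explicit by
  \<open>cube_of\<close>.\<close>

locale vertex_placement =
  fixes D :: "nat set" and X :: "('x, 'm) collection_scheme" and g :: "nat \<Rightarrow> 'x \<Rightarrow> nat \<Rightarrow> cube"
  assumes g_support: "\<And>n x a k. x \<in> elems X {1..n} \<Longrightarrow> a \<in> {1..n} \<Longrightarrow> k \<notin> D \<Longrightarrow> g n x a k = []"
    and g_apart: "\<And>n x a b. x \<in> elems X {1..n} \<Longrightarrow> a \<in> {1..n} \<Longrightarrow> b \<in> {1..n} \<Longrightarrow> a \<noteq> b \<Longrightarrow>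
      apart (g n x a) (g n x b)"
    and g_pull: "\<And>n x \<sigma> a. x \<in> elems X {1..n} \<Longrightarrow> \<sigma> permutes {1..n} \<Longrightarrow> a \<in> {1..n} \<Longrightarrow>
      g n (pull X {1..n} {1..n} \<sigma> x) a = g n x (\<sigma> a)"
begin

lemma leaf_cube_support: "leaf_cube g t a u \<Longrightarrow> decorated X t \<Longrightarrow> k \<notin> D \<Longrightarrow> u k = []"
  by (induction rule: leaf_cube.induct) (auto simp: subcube_def g_support)

text \<open>Two root-to-leaf paths share vertices until they separate at one of them. There
  \<open>g_apart\<close> makes the cubes disjoint, the remaining vertices only shrink them, and the
  common initial part preserves disjointness. The case \<open>a = b\<close> gives uniqueness of the
  cube of a leaf.\<close>

lemma leaf_cube_apart:
  "leaf_cube g t a u \<Longrightarrow> leaf_cube g t b v \<Longrightarrow> decorated X t \<Longrightarrow> distinct (leaves t) \<Longrightarrow>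
    if a = b then u = v else apart u v"
proof (induction arbitrary: v rule: leaf_cube.induct)
  case (Leaf a)
  then show ?case by (auto elim: leaf_cube.cases)
next
  case (Node i ts a u x)
  from Node.prems(1) obtain j w where j: "j < length ts" "leaf_cube g (ts ! j) b w"
    and v: "v = g (length ts) x (Suc j) \<odot> w"
    by (auto elim: leaf_cube.cases)
  show ?case
  proof (cases "i = j")
    case True
    have "distinct (leaves (ts ! i))"
      using Node.prems(3) Node.hyps(1) by (auto simp: distinct_concat_iff)
    then show ?thesis
      using True Node.IH[of w] j Node.prems(2) Node.hyps(1) v apart_subcube_same
      by (auto split: if_splits)
  next
    case False
    have "set (leaves (ts ! i)) \<inter> set (leaves (ts ! j)) = {}"
      using distinct_concat_nth_disjoint[of "map leaves ts" i j] Node.prems(3) Node.hyps(1) j False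
      by simp
    then have "a \<noteq> b" using leaf_cube_leaves[OF Node.hyps(2)] leaf_cube_leaves[OF j(2)] by auto
    moreover have "apart (g (length ts) x (Suc i)) (g (length ts) x (Suc j))"
      using False Node.prems(2) Node.hyps(1) j by (intro g_apart) auto
    ultimately show ?thesis using v apart_subcube by auto
  qed
qed

lemma cube_of_eq:
  assumes "t \<in> elems (tree_operad X) A" "leaf_cube g t a u"
  shows "cube_of g t a = u"
  unfolding cube_of_def
proof (rule the_equality)
  fix v assume "leaf_cube g t a v"
  then show "v = u" using leaf_cube_apart[OF _ assms(2)] assms(1) by (force simp: in_tree_operad)
qed (fact assms)

lemma leaf_cube_cube_of:
  assumes "t \<in> elems (tree_operad X) A" "a \<in> A"
  shows "leaf_cube g t a (cube_of g t a)"
  using assms leaf_cube_exists cube_of_eq by (metis in_tree_operad)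

lemma cube_of_corolla:
  assumes "x \<in> elems X {1..n}" "a \<in> {1..n}"
  shows "cube_of g (corolla n x) a = g n x a"
proof -
  let ?ts = "map Leaf [1..<n + 1] :: 'x tree list"
  have len: "length ?ts = n" by simp
  \<comment> \<open>Inputs are labelled from 1 and list positions from 0.\<close>
  have "?ts ! (a - 1) = Leaf a" using assms(2) by (subst nth_map) (auto simp del: upt_Suc)
  then have "leaf_cube g (?ts ! (a - 1)) a (\<lambda>_. [])" by (simp add: leaf_cube.Leaf)
  then have "leaf_cube g (Node x ?ts) a (g (length ?ts) x (Suc (a - 1)) \<odot> (\<lambda>_. []))"
    using assms(2) by (intro leaf_cube.Node) (auto simp: len)
  moreover have "Suc (a - 1) = a" using assms(2) by simp
  ultimately have "leaf_cube g (corolla n x) a (g n x a)" unfolding len by (simp add: corolla_def)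
  then show ?thesis using assms(1) cube_of_eq corolla_in_tree_operad by metis
qed

text \<open>Relabelling moves leaf cubes unchanged and substitution concatenates them. The remaining
  work is to check that grafting again labels the leaves bijectively.\<close>

lemma tree_operad_placement: "placement D (tree_operad X) (\<lambda>_. cube_of g)"
proof
  fix A B :: "nat set" and f t
  assume A: "finite A" "A \<noteq> {}" "bij_betw f A B" and t: "t \<in> elems (tree_operad X) B"
  have pullT: "pull (tree_operad X) A B f t = relabel (inv_into A f) t" by (simp add: tree_operad_def)
  have inv: "bij_betw (inv_into A f) B A" using A(3) by (rule bij_betw_inv_into)
  have "leaves (relabel (inv_into A f) t) = map (inv_into A f) (leaves t)"
    by (simp add: leaves_subst_leaves concat_map_singleton)
  then show closed: "pull (tree_operad X) A B f t \<in> elems (tree_operad X) A"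
    using t inv by (auto simp: pullT in_tree_operad distinct_map bij_betw_def decorated_subst_leaves)
  fix a assume a: "a \<in> A"
  then have "f a \<in> B" using A(3) by (auto simp: bij_betw_def)
  then have "leaf_cube g t (f a) (cube_of g t (f a))" using t by (intro leaf_cube_cube_of)
  \<comment> \<open>Pulling back along \<open>f\<close> renames the leaf \<open>f a\<close> to
    \<open>a\<close>, since labels move by the inverse of \<open>f\<close>.\<close>
  then have "leaf_cube g (relabel (inv_into A f) t) a (cube_of g t (f a))"
    using leaf_cube_relabel[of g t "f a" _ "inv_into A f"] a A(3)
    by (metis bij_betw_inv_into_left)
  then show "cube_of g (pull (tree_operad X) A B f t) a = cube_of g t (f a)"
    using closed cube_of_eq pullT by metis
next
  show one: "one (tree_operad X) \<in> elems (tree_operad X) {1}" by (simp add: tree_operad_def)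
  show "cube_of g (one (tree_operad X)) 1 = (\<lambda>_. [])"
    by (rule cube_of_eq[OF one]) (simp add: tree_operad_def leaf_cube.Leaf)
next
  fix t ns us
  assume us: "length us = length ns" "t \<in> elems (tree_operad X) {1..length ns}"
    "\<And>i. i < length ns \<Longrightarrow> us ! i \<in> elems (tree_operad X) {1..ns ! i}"
  define s where "s i = relabel (\<lambda>j. sum_list (take (i - 1) ns) + j) (us ! (i - 1))" for i
  have compT: "comp (tree_operad X) t ns us = subst_leaves s t"
    by (simp add: tree_operad_def s_def[abs_def])
  have leaves_s: "leaves (s (Suc i)) = map (\<lambda>j. sum_list (take i ns) + j) (leaves (us ! i))" for i
    by (simp add: s_def leaves_subst_leaves concat_map_singleton)
  have s: "decorated X (s a)" "distinct (leaves (s a))"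
    "set (leaves (s a)) = (\<lambda>j. sum_list (take (a - 1) ns) + j) ` {1..ns ! (a - 1)}"
    if a: "a \<in> {1..length ns}" for a
  proof -
    obtain i where i: "a = Suc i" "i < length ns" using a by (cases a) auto
    with us(3)[of i] show "decorated X (s a)" "distinct (leaves (s a))"
      "set (leaves (s a)) = (\<lambda>j. sum_list (take (a - 1) ns) + j) ` {1..ns ! (a - 1)}"
      by (simp_all add: in_tree_operad leaves_s distinct_map)
        (simp add: s_def decorated_subst_leaves)
  qed
  have t: "decorated X t" "distinct (leaves t)" "set (leaves t) = {1..length ns}"
    using us(2) by (auto simp: in_tree_operad)
  have "distinct (leaves (subst_leaves s t))"
    unfolding leaves_subst_leaves
  proof (rule distinct_concat_map)
    fix a b assume ab: "a \<in> set (leaves t)" "b \<in> set (leaves t)" "a \<noteq> b"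
    \<comment> \<open>A shared label would lie in blocks \<open>a - 1\<close> and
      \<open>b - 1\<close> at once. Leaf labels of \<open>t\<close> are at least 1, so truncated
      subtraction keeps distinct leaves distinct.\<close>
    have "a - 1 = b - 1"
      if "j \<in> {1..ns ! (a - 1)}" "j' \<in> {1..ns ! (b - 1)}"
        "sum_list (take (a - 1) ns) + j = sum_list (take (b - 1) ns) + j'" for j j'
      using ab t(3) that by (intro block_unique[of "a - 1" ns j "b - 1" j']) auto
    moreover have "a - 1 \<noteq> b - 1" using ab t(3) by auto
    ultimately show "set (leaves (s a)) \<inter> set (leaves (s b)) = {}"
      using ab t(3) s(3)[of a] s(3)[of b] by (fastforce simp del: image_add_atLeastAtMost)
  qed (use s t in auto)
  moreover have "set (leaves (subst_leaves s t)) = {1..sum_list ns}"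
  proof
    show "set (leaves (subst_leaves s t)) \<subseteq> {1..sum_list ns}"
    proof
      fix b assume "b \<in> set (leaves (subst_leaves s t))"
      then obtain a where a: "a \<in> {1..length ns}" "b \<in> set (leaves (s a))"
        using t by (auto simp: leaves_subst_leaves)
      then obtain j where "j \<in> {1..ns ! (a - 1)}" "b = sum_list (take (a - 1) ns) + j"
        using s(3)[of a] by (auto simp del: image_add_atLeastAtMost)
      then show "b \<in> {1..sum_list ns}" using a(1) block_mem[of "a - 1" ns j] by force
    qed
    show "{1..sum_list ns} \<subseteq> set (leaves (subst_leaves s t))"
    proof
      fix b assume "b \<in> {1..sum_list ns}"
      then obtain i j where ij: "i < length ns" "j \<in> {1..ns ! i}" "b = sum_list (take i ns) + j"
        by (rule block_exists)
      moreover have "Suc i \<in> {1..length ns}" using ij(1) by simp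
      ultimately have "b \<in> set (leaves (s (Suc i)))" by (simp only: s(3) diff_Suc_1 imageI)
      moreover have "Suc i \<in> set (leaves t)" using \<open>Suc i \<in> {1..length ns}\<close> t(3) by simp
      ultimately show "b \<in> set (leaves (subst_leaves s t))"
        unfolding leaves_subst_leaves set_concat set_map by blast
    qed
  qed
  ultimately show closed: "comp (tree_operad X) t ns us \<in> elems (tree_operad X) {1..sum_list ns}"
    using s t by (auto simp: compT in_tree_operad intro: decorated_subst_leaves)
  fix i j assume ij: "i < length ns" "j \<in> {1..ns ! i}"
  have "leaf_cube g t (Suc i) (cube_of g t (Suc i))"
    using us(2) ij by (intro leaf_cube_cube_of) auto
  moreover have "leaf_cube g (us ! i) j (cube_of g (us ! i) j)"
    using us(3) ij by (intro leaf_cube_cube_of)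
  then have "leaf_cube g (s (Suc i)) (sum_list (take i ns) + j) (cube_of g (us ! i) j)"
    unfolding s_def diff_Suc_1 by (rule leaf_cube_relabel)
  ultimately have "leaf_cube g (subst_leaves s t) (sum_list (take i ns) + j)
      (cube_of g t (Suc i) \<odot> cube_of g (us ! i) j)"
    by (rule leaf_cube_subst_leaves)
  then show "cube_of g (comp (tree_operad X) t ns us) (sum_list (take i ns) + j)
      = cube_of g t (Suc i) \<odot> cube_of g (us ! i) j"
    using closed cube_of_eq compT by metis
next
  fix A :: "nat set" and t a k
  assume "t \<in> elems (tree_operad X) A" "a \<in> A" "k \<notin> D"
  then show "cube_of g t a k = []"
    using leaf_cube_support[OF leaf_cube_cube_of] by (simp add: in_tree_operad)
next
  fix A :: "nat set" and t and a b :: nat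
  assume "t \<in> elems (tree_operad X) A" "a \<in> A" "b \<in> A" "a \<noteq> b"
  then show "apart (cube_of g t a) (cube_of g t b)"
    using leaf_cube_apart[of t a _ b, OF leaf_cube_cube_of leaf_cube_cube_of]
    unfolding in_tree_operad by metis
qed

text \<open>The equivariance relation compares two corollas, and \<open>g_pull\<close> says that
  they receive the same cubes; the placement of trees then passes to the quotient.\<close>

lemma free_operad_placement:
  "placement D (free_operad X) (\<lambda>A C. cube_of g (rep C))"
  "\<And>n x a. x \<in> elems X {1..n} \<Longrightarrow> a \<in> {1..n} \<Longrightarrow> cube_of g (rep (free_gen X n x)) a = g n x a"
proof -
  interpret tree: placement D "tree_operad X" "\<lambda>_. cube_of g" by (rule tree_operad_placement)
  have R: "cube_of g t a = cube_of g u a"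
    if "equivariance X n t u" "t \<in> elems (tree_operad X) {1..n}" "a \<in> {1..n}" for n t u a
    using that(1)
  proof cases
    case (1 x \<sigma>)
    have "\<sigma> a \<in> {1..n}" using that(3) 1(4) by (simp only: permutes_in_image)
    moreover have "cube_of g u a = cube_of g (corolla n x) (\<sigma> a)"
      unfolding 1(2) using that(3) 1(3) permutes_imp_bij[OF 1(4)]
      by (intro tree.place_pull) (auto simp: corolla_in_tree_operad)
    moreover have "pull X {1..n} {1..n} \<sigma> x \<in> elems X {1..n}"
      using that(2) 1(1) by (simp add: corolla_in_tree_operad)
    ultimately show ?thesis using 1 that(3) by (simp add: cube_of_corolla g_pull)
  qed
  then have R: "tree.compatible (equivariance X)" by (auto simp: tree.compatible_def)
  show "placement D (free_operad X) (\<lambda>A C. cube_of g (rep C))"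
    unfolding free_operad_def by (rule tree.quotient_placement(1)[OF R])
  show "cube_of g (rep (free_gen X n x)) a = g n x a"
    if "x \<in> elems X {1..n}" "a \<in> {1..n}" for n x a
    unfolding free_gen_def
    using tree.quotient_placement(2)[OF R] that
    by (simp add: cube_of_corolla corolla_in_tree_operad)
qed

end

lemma free_gen_closed: "x \<in> elems X {1..n} \<Longrightarrow> free_gen X n x \<in> elems (free_operad X) {1..n}"
  using corolla_in_tree_operad[of n x X]
  by (simp add: free_gen_def free_operad_def quotient_operad_def)

section \<open>Tensor products\<close>

text \<open>The permutation transposes a grid with \<open>k\<close> rows and \<open>l\<close>
  columns, and \<open>interchange_perm l k\<close> transposes it back.\<close>

lemma interchange_perm_bij: "bij_betw (interchange_perm k l) {1..k * l} {1..k * l}"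
proof -
  have *: "interchange_perm k l m \<in> {1..l * k} \<and> interchange_perm l k (interchange_perm k l m) = m"
    if m: "m \<in> {1..k * l}" for k l m
  proof -
    obtain i j where ij: "i < k" "j \<in> {1..l}" "m = i * l + j"
      using m by (rule grid_exists)
    have "interchange_perm k l m = (j - 1) * k + Suc i"
      using interchange_perm_eq[of "Suc i" k j l] ij by simp
    moreover have "(j - 1) * k + Suc i \<in> {1..l * k}"
      using block_mem[of "j - 1" "replicate l k" "Suc i"] ij by (auto simp: sum_list_replicate)
    ultimately show ?thesis
      using interchange_perm_eq[of j l "Suc i" k] ij by simp
  qed
  show ?thesis
    using *[of _ k l] *[of _ l k]
    by (intro bij_betwI[where g = "interchange_perm l k"]) (auto simp: mult.commute)
qed

locale placement_pair = left: placement D P h + right: placement E Q h' for D P h E Q h'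
begin

abbreviation "coproduct_vertex \<equiv> (\<lambda>n. case_sum (h {1..n}) (h' {1..n}))"

text \<open>Every vertex label comes from exactly one factor, so each condition reduces to the same
  condition for \<open>P\<close> or for \<open>Q\<close>.\<close>

sublocale vertex_placement "D \<union> E" "coproduct_collection P Q" coproduct_vertex
proof
  fix n z and a k :: nat
  assume "z \<in> elems (coproduct_collection P Q) {1..n}" "a \<in> {1..n}" "k \<notin> D \<union> E"
  then show "coproduct_vertex n z a k = []"
    by (cases z) (auto simp: coproduct_collection_def left.support right.support)
next
  fix n z and a b :: nat
  assume "z \<in> elems (coproduct_collection P Q) {1..n}" "a \<in> {1..n}" "b \<in> {1..n}" "a \<noteq> b"
  then show "apart (coproduct_vertex n z a) (coproduct_vertex n z b)"
    by (cases z) (auto simp: coproduct_collection_def left.apart right.apart)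
next
  fix n z \<sigma> and a :: nat
  assume z: "z \<in> elems (coproduct_collection P Q) {1..n}" and \<sigma>: "\<sigma> permutes {1..n}"
    and a: "a \<in> {1..n}"
  have "{1..n} \<noteq> {}" using a by auto
  then show "coproduct_vertex n (pull (coproduct_collection P Q) {1..n} {1..n} \<sigma> z) a
      = coproduct_vertex n z (\<sigma> a)"
    using z a permutes_imp_bij[OF \<sigma>]
    by (cases z) (auto simp: coproduct_collection_def left.place_pull right.place_pull)
qed

sublocale free: placement "D \<union> E" "free_operad (coproduct_collection P Q)"
    "\<lambda>A C. cube_of coproduct_vertex (rep C)"
  by (rule free_operad_placement(1))

lemma pregen_closed:
  "p \<in> elems P {1..n} \<Longrightarrow>
    pregen_left P Q n p \<in> elems (free_operad (coproduct_collection P Q)) {1..n}"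
  "q \<in> elems Q {1..n} \<Longrightarrow>
    pregen_right P Q n q \<in> elems (free_operad (coproduct_collection P Q)) {1..n}"
  by (auto intro!: free_gen_closed simp: coproduct_collection_def)

lemma place_pregen:
  "p \<in> elems P {1..n} \<Longrightarrow> a \<in> {1..n} \<Longrightarrow>
    cube_of coproduct_vertex (rep (pregen_left P Q n p)) a = h {1..n} p a"
  "q \<in> elems Q {1..n} \<Longrightarrow> a \<in> {1..n} \<Longrightarrow>
    cube_of coproduct_vertex (rep (pregen_right P Q n q)) a = h' {1..n} q a"
  by (subst free_operad_placement(2); auto simp: coproduct_collection_def)+

text \<open>The relations force the inclusions to be morphisms, and \<open>h\<close> and
  \<open>h'\<close> already respect units and composition. For a composite,
  \<open>place_comp\<close> is used once in the factor and once, backwards, in the free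
  operad.\<close>

lemma compatible_coproduct_relation: "free.compatible (coproduct_relation P Q)"
  unfolding free.compatible_def
proof (intro allI ballI impI)
  fix n x y and a :: nat
  assume "coproduct_relation P Q n x y" and a: "a \<in> {1..n}"
  then show "cube_of coproduct_vertex (rep x) a = cube_of coproduct_vertex (rep y) a"
  proof cases
    case one_left
    then have "a = 1" using a by simp
    then show ?thesis
      using one_left left.one_closed left.place_one free.place_one by (simp add: place_pregen)
  next
    case one_right
    then have "a = 1" using a by simp
    then show ?thesis
      using one_right right.one_closed right.place_one free.place_one by (simp add: place_pregen)
  next
    case (comp_left p ns ps)
    obtain i j where ij: "i < length ns" "j \<in> {1..ns ! i}" "a = sum_list (take i ns) + j"
      using a unfolding comp_left(1) by (rule block_exists)
    then have i: "Suc i \<in> {1..length ns}" by simp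
    have "cube_of coproduct_vertex (rep x) a = h {1..sum_list ns} (comp P p ns ps) a"
      unfolding comp_left(2) using a comp_left by (intro place_pregen left.comp_closed) auto
    also have "\<dots> = h {1..length ns} p (Suc i) \<odot> h {1..ns ! i} (ps ! i) j"
      unfolding ij(3) using comp_left ij by (intro left.place_comp)
    also have "\<dots> = cube_of coproduct_vertex (rep (pregen_left P Q (length ns) p)) (Suc i)
        \<odot> cube_of coproduct_vertex (rep (map2 (pregen_left P Q) ns ps ! i)) j"
      using comp_left ij i by (simp add: place_pregen)
    also have "\<dots> = cube_of coproduct_vertex (rep y) a"
      unfolding comp_left(3) ij(3) using comp_left ij
      by (intro free.place_comp[symmetric]) (auto intro: pregen_closed)
    finally show ?thesis .
  next
    case (comp_right q ns qs)
    obtain i j where ij: "i < length ns" "j \<in> {1..ns ! i}" "a = sum_list (take i ns) + j"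
      using a unfolding comp_right(1) by (rule block_exists)
    then have i: "Suc i \<in> {1..length ns}" by simp
    have "cube_of coproduct_vertex (rep x) a = h' {1..sum_list ns} (comp Q q ns qs) a"
      unfolding comp_right(2) using a comp_right by (intro place_pregen right.comp_closed) auto
    also have "\<dots> = h' {1..length ns} q (Suc i) \<odot> h' {1..ns ! i} (qs ! i) j"
      unfolding ij(3) using comp_right ij by (intro right.place_comp)
    also have "\<dots> = cube_of coproduct_vertex (rep (pregen_right P Q (length ns) q)) (Suc i)
        \<odot> cube_of coproduct_vertex (rep (map2 (pregen_right P Q) ns qs ! i)) j"
      using comp_right ij i by (simp add: place_pregen)
    also have "\<dots> = cube_of coproduct_vertex (rep y) a"
      unfolding comp_right(3) ij(3) using comp_right ij
      by (intro free.place_comp[symmetric]) (auto intro: pregen_closed)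
    finally show ?thesis .
  qed
qed

sublocale coproduct: placement "D \<union> E" "coproduct_operad P Q"
    "\<lambda>A C. cube_of coproduct_vertex (rep (rep C))"
  unfolding coproduct_operad_def
  by (rule free.quotient_placement(1)[OF compatible_coproduct_relation])

lemma inj_closed:
  "p \<in> elems P {1..n} \<Longrightarrow> inj_left P Q n p \<in> elems (coproduct_operad P Q) {1..n}"
  "q \<in> elems Q {1..n} \<Longrightarrow> inj_right P Q n q \<in> elems (coproduct_operad P Q) {1..n}"
  using pregen_closed
  by (auto simp: inj_left_def inj_right_def coproduct_operad_def quotient_operad_def)

lemma place_inj:
  "p \<in> elems P {1..n} \<Longrightarrow> a \<in> {1..n} \<Longrightarrow>
    cube_of coproduct_vertex (rep (rep (inj_left P Q n p))) a = h {1..n} p a"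
  "q \<in> elems Q {1..n} \<Longrightarrow> a \<in> {1..n} \<Longrightarrow>
    cube_of coproduct_vertex (rep (rep (inj_right P Q n q))) a = h' {1..n} q a"
  unfolding inj_left_def inj_right_def
  by (simp_all add: free.quotient_placement(2)[OF compatible_coproduct_relation]
      pregen_closed place_pregen)

text \<open>Both composites give the cell in row \<open>i\<close>, column \<open>j\<close> the
  product of the cube at input \<open>i\<close> of \<open>p\<close> and the cube at input
  \<open>j\<close> of \<open>q\<close>, in opposite orders. As the two subdivide in disjoint sets of
  directions, these products agree.\<close>

lemma compatible_interchange:
  assumes "D \<inter> E = {}"
  shows "coproduct.compatible (interchange P Q)"
  unfolding coproduct.compatible_def
proof (intro allI ballI impI)
  let ?c = "\<lambda>C. cube_of coproduct_vertex (rep (rep C))"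
  fix n x y and a :: nat
  assume "interchange P Q n x y" and a: "a \<in> {1..n}"
  then show "?c x a = ?c y a"
  proof cases
    case (1 p k q l)
    let ?qp = "comp (coproduct_operad P Q)
      (inj_right P Q l q) (replicate l k) (replicate l (inj_left P Q k p))"
    \<comment> \<open>Here \<open>i\<close> counts from 0 and \<open>j\<close> from 1: the cell is
      in row \<open>Suc i\<close>, column \<open>j\<close>. In the other composite it is position
      \<open>Suc i\<close> of block \<open>j - 1\<close>.\<close>
    obtain i j where ij: "i < k" "j \<in> {1..l}" "a = i * l + j"
      using a unfolding 1(1) by (rule grid_exists)
    then have i: "Suc i \<in> {1..k}" by simp
    have j: "Suc (j - 1) = j" using ij by simp
    note closed = inj_closed(1)[OF 1(4)] inj_closed(2)[OF 1(5)]
    have "?c x a = ?c (inj_left P Q k p) (Suc i) \<odot> ?c (inj_right P Q l q) j"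
      using coproduct.place_comp[of "replicate k (inj_right P Q l q)" "replicate k l"
          "inj_left P Q k p" i j] closed ij
      by (simp add: 1(2) sum_list_replicate)
    also have "\<dots> = h {1..k} p (Suc i) \<odot> h' {1..l} q j"
      using 1 ij i by (simp add: place_inj)
    also have "\<dots> = h' {1..l} q j \<odot> h {1..k} p (Suc i)"
      using left.support[OF 1(4) i] right.support[OF 1(5) ij(2)] assms by (rule subcube_commute)
    also have "\<dots> = ?c (inj_right P Q l q) j \<odot> ?c (inj_left P Q k p) (Suc i)"
      using 1 ij i by (simp add: place_inj)
    also have "\<dots> = ?c ?qp ((j - 1) * k + Suc i)"
      using coproduct.place_comp[of "replicate l (inj_left P Q k p)" "replicate l k"
          "inj_right P Q l q" "j - 1" "Suc i"] closed ij i j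
      by (simp add: sum_list_replicate)
    also have "(j - 1) * k + Suc i = interchange_perm k l a"
      using interchange_perm_eq[of "Suc i" k j l] ij by simp
    also have "?c ?qp (interchange_perm k l a) = ?c y a"
    proof -
      have "?qp \<in> elems (coproduct_operad P Q) {1..k * l}"
        using coproduct.comp_closed[of "replicate l (inj_left P Q k p)" "replicate l k"
            "inj_right P Q l q"] closed
        by (simp add: sum_list_replicate mult.commute)
      moreover have "{1..k * l} \<noteq> {}" using a 1(1) by auto
      ultimately show ?thesis
        using coproduct.place_pull[OF _ _ interchange_perm_bij, of k l ?qp a] a 1 by simp
    qed
    finally show ?thesis .
  qed
qed

lemma BV_tensor_placement:
  assumes "D \<inter> E = {}"
  shows "placement (D \<union> E) (BV_tensor P Q) (\<lambda>A C. cube_of coproduct_vertex (rep (rep (rep C))))"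
  unfolding BV_tensor_def
  by (rule coproduct.quotient_placement(1)[OF compatible_interchange[OF assms]])

end

text \<open>In the induction the first \<open>m\<close> factors occupy directions
  \<open>{1..m}\<close> and the next one the fresh direction \<open>Suc m\<close>, so the
  disjointness required by \<open>BV_tensor_placement\<close> holds. Injectivity of
  \<open>Base\<close> and \<open>encode\<close> carries placements to the fixed type.\<close>

lemma iterated_BV_tensor_placement:
  assumes "d \<ge> 1" "\<And>k. 1 \<le> k \<Longrightarrow> k \<le> d \<Longrightarrow> \<exists>h. placement {k} (P k) h"
  shows "\<exists>h. placement {1..d} (iterated_BV_tensor d P) h"
proof -
  have factor: "\<exists>h. placement {k} (transport Base (P k)) h" if k: "1 \<le> k" "k \<le> d" for k
  proof -
    from assms(2)[OF k] obtain h where "placement {k} (P k) h" ..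
    then interpret placement "{k}" "P k" h .
    have "inj_on Base (elems (P k) A)" for A by (auto intro: inj_onI)
    from transport_placement[OF this] show ?thesis by blast
  qed
  have "m \<le> d \<Longrightarrow> \<exists>h. placement {1..m} (iterated_BV_tensor m P) h" if "1 \<le> m" for m
    using that
  proof (induction rule: dec_induct)
    case base
    then show ?case using factor[of 1] by (simp add: iterated_BV_tensor_def)
  next
    case (step m)
    let ?T = "iterated_BV_tensor m P" and ?Q = "transport Base (P (Suc m))"
    obtain h where "placement {1..m} ?T h" using step by auto
    moreover obtain h' where "placement {Suc m} ?Q h'" using factor[of "Suc m"] step by auto
    ultimately interpret placement_pair "{1..m}" ?T h "{Suc m}" ?Q h'
      by (rule placement_pair.intro)
    interpret BV: placement "{1..m} \<union> {Suc m}" "BV_tensor ?T ?Q"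
      "\<lambda>A C. cube_of coproduct_vertex (rep (rep (rep C)))"
      by (rule BV_tensor_placement) simp
    have "{1..m} \<union> {Suc m} = {1..Suc m}" using step by auto
    \<comment> \<open>The list \<open>[2..<Suc m + 1]\<close> ends in \<open>Suc m\<close>, so the
      fold makes exactly one further step.\<close>
    moreover have "iterated_BV_tensor (Suc m) P = transport encode (BV_tensor ?T ?Q)"
      using step by (simp add: iterated_BV_tensor_def flip: Suc_eq_plus1)
    moreover note BV.transport_placement[OF inj_on_encode]
    ultimately show ?case by auto
  qed
  then show ?thesis using assms(1) by blast
qed

section \<open>Free symmetric collections\<close>

locale free_symmetric_collection =
  fixes X :: "('x, 'm) collection_scheme" and n :: nat
  assumes symmetric: "symmetric_collection X" and free: "acts_freely X n" and n: "n \<ge> 1"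
begin

abbreviation act :: "(nat \<Rightarrow> nat) \<Rightarrow> 'x \<Rightarrow> 'x" where
  "act \<equiv> pull X {1..n} {1..n}"

text \<open>The condition on \<open>r\<close> depends only on the orbit of \<open>x\<close>, so the
  choice operator returns the same representative throughout an orbit.\<close>

definition orbit_rep :: "'x \<Rightarrow> 'x" where
  "orbit_rep x = (SOME r. r \<in> elems X {1..n} \<and> (\<exists>\<sigma>. \<sigma> permutes {1..n} \<and> x = act \<sigma> r))"

definition orbit_perm :: "'x \<Rightarrow> nat \<Rightarrow> nat" where
  "orbit_perm x = (SOME \<sigma>. \<sigma> permutes {1..n} \<and> x = act \<sigma> (orbit_rep x))"

lemma act_closed: "\<sigma> permutes {1..n} \<Longrightarrow> x \<in> elems X {1..n} \<Longrightarrow> act \<sigma> x \<in> elems X {1..n}"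
  using symmetric n unfolding symmetric_collection_def
  by (metis atLeastatMost_empty_iff2 finite_atLeastAtMost not_less permutes_imp_bij)

lemma act_id: "x \<in> elems X {1..n} \<Longrightarrow> act id x = x"
  using symmetric n unfolding symmetric_collection_def
  by (metis atLeastatMost_empty_iff2 finite_atLeastAtMost not_less)

lemma act_act:
  assumes "\<sigma> permutes {1..n}" "\<tau> permutes {1..n}" "x \<in> elems X {1..n}"
  shows "act \<tau> (act \<sigma> x) = act (\<sigma> \<circ> \<tau>) x"
proof -
  have "{1..n} \<noteq> {}" using n by simp
  then show ?thesis
    using symmetric permutes_imp_bij[OF assms(1)] permutes_imp_bij[OF assms(2)] assms(3)
    unfolding symmetric_collection_def by (metis finite_atLeastAtMost)
qed

text \<open>Acting by the inverse of \<open>\<tau>\<close> turns the equality into a fixed point of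
  \<open>\<sigma> \<circ> inv \<tau>\<close>, to which freeness applies.\<close>

lemma act_inj:
  assumes "\<sigma> permutes {1..n}" "\<tau> permutes {1..n}" "x \<in> elems X {1..n}" "act \<sigma> x = act \<tau> x"
  shows "\<sigma> = \<tau>"
proof -
  have inv: "inv \<tau> permutes {1..n}" using assms(2) by (rule permutes_inv)
  have "act (\<sigma> \<circ> inv \<tau>) x = act (\<tau> \<circ> inv \<tau>) x"
    using assms inv by (simp flip: act_act)
  also have "\<dots> = x" using assms by (simp add: permutes_inv_o act_id)
  finally have "\<sigma> \<circ> inv \<tau> = id"
    using free assms(3) permutes_compose[OF inv assms(1)] by (auto simp: acts_freely_def)
  then have "\<sigma> \<circ> (inv \<tau> \<circ> \<tau>) = \<tau>" by (metis comp_assoc id_comp)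
  then show ?thesis using assms(2) by (simp add: permutes_inv_o)
qed

lemma orbit_rep_closed: "x \<in> elems X {1..n} \<Longrightarrow> orbit_rep x \<in> elems X {1..n}"
  and orbit_perm: "x \<in> elems X {1..n} \<Longrightarrow> orbit_perm x permutes {1..n}"
    "x \<in> elems X {1..n} \<Longrightarrow> act (orbit_perm x) (orbit_rep x) = x"
proof -
  assume x: "x \<in> elems X {1..n}"
  then have "\<exists>r. r \<in> elems X {1..n} \<and> (\<exists>\<sigma>. \<sigma> permutes {1..n} \<and> x = act \<sigma> r)"
    using act_id permutes_id by metis
  then have r: "orbit_rep x \<in> elems X {1..n} \<and> (\<exists>\<sigma>. \<sigma> permutes {1..n} \<and> x = act \<sigma> (orbit_rep x))"
    unfolding orbit_rep_def by (rule someI_ex)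
  then show "orbit_rep x \<in> elems X {1..n}" by blast
  from r have "\<exists>\<sigma>. \<sigma> permutes {1..n} \<and> x = act \<sigma> (orbit_rep x)" by blast
  then have "orbit_perm x permutes {1..n} \<and> x = act (orbit_perm x) (orbit_rep x)"
    unfolding orbit_perm_def by (rule someI_ex)
  then show "orbit_perm x permutes {1..n}" "act (orbit_perm x) (orbit_rep x) = x" by simp_all
qed

text \<open>Composition with \<open>\<tau>\<close> or its inverse shows that \<open>x\<close> and
  \<open>x.\<tau>\<close> define the same predicate under the choice operator.\<close>

lemma orbit_rep_act:
  assumes x: "x \<in> elems X {1..n}" and \<tau>: "\<tau> permutes {1..n}"
  shows "orbit_rep (act \<tau> x) = orbit_rep x"
proof -
  have "(\<exists>\<sigma>. \<sigma> permutes {1..n} \<and> act \<tau> x = act \<sigma> r) \<longleftrightarrow> (\<exists>\<sigma>. \<sigma> permutes {1..n} \<and> x = act \<sigma> r)"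
    (is "?L \<longleftrightarrow> ?R") if r: "r \<in> elems X {1..n}" for r
  proof
    assume ?R
    then show ?L using act_act r \<tau> permutes_compose by metis
  next
    assume ?L
    then obtain \<sigma> where \<sigma>: "\<sigma> permutes {1..n}" "act \<tau> x = act \<sigma> r" by blast
    have inv: "inv \<tau> permutes {1..n}" using \<tau> by (rule permutes_inv)
    have "x = act (inv \<tau>) (act \<tau> x)"
      using act_act[OF \<tau> inv x] x \<tau> by (simp add: permutes_inv_o act_id)
    also have "\<dots> = act (\<sigma> \<circ> inv \<tau>) r" using \<sigma> inv r by (simp add: act_act)
    finally show ?R using permutes_compose[OF inv \<sigma>(1)] by blast
  qed
  then show ?thesis unfolding orbit_rep_def by (metis (mono_tags, lifting))
qed

text \<open>Both permutations send the common representative to \<open>x.\<tau>\<close>, so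
  freeness, through \<open>act_inj\<close>, identifies them.\<close>

lemma orbit_perm_act:
  assumes x: "x \<in> elems X {1..n}" and \<tau>: "\<tau> permutes {1..n}"
  shows "orbit_perm (act \<tau> x) = orbit_perm x \<circ> \<tau>"
proof (rule act_inj)
  show "orbit_perm (act \<tau> x) permutes {1..n}" using x \<tau> by (intro orbit_perm act_closed)
  show "orbit_perm x \<circ> \<tau> permutes {1..n}" using x \<tau> by (intro permutes_compose orbit_perm)
  show "orbit_rep x \<in> elems X {1..n}" using x by (rule orbit_rep_closed)
  have "act (orbit_perm (act \<tau> x)) (orbit_rep x) = act \<tau> x"
    using orbit_perm(2)[OF act_closed[OF \<tau> x]] orbit_rep_act[OF x \<tau>] by simp
  also have "\<dots> = act (orbit_perm x \<circ> \<tau>) (orbit_rep x)"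
    using x \<tau> by (simp add: orbit_perm orbit_rep_closed flip: act_act)
  finally show "act (orbit_perm (act \<tau> x)) (orbit_rep x)
      = act (orbit_perm x \<circ> \<tau>) (orbit_rep x)" .
qed

end

text \<open>The cube is undivided in every direction except \<open>k\<close>, where a single letter
  names the piece assigned to input \<open>a\<close>.\<close>

definition slab :: "nat \<Rightarrow> ('x, 'm) collection_scheme \<Rightarrow> nat \<Rightarrow> 'x \<Rightarrow> nat \<Rightarrow> cube" where
  "slab k X n x a = (\<lambda>_. [])(k := [free_symmetric_collection.orbit_perm X n x a])"

text \<open>Different inputs get different letters because \<open>orbit_perm\<close> is injective,
  and distinct one-letter words are incomparable. Equivariance is
  \<open>orbit_perm_act\<close>.\<close>

lemma slab_vertex_placement:
  assumes "symmetric_collection X" "free_collection X"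
  shows "vertex_placement {k} X (slab k X)"
proof -
  \<comment> \<open>The locale requires \<open>n \<ge> 1\<close>, which the existence of an input
    \<open>a\<close> supplies.\<close>
  have X: "free_symmetric_collection X n" if "a \<in> {1..n}" for n a
    using assms that by unfold_locales (auto simp: free_collection_def)
  show ?thesis
  proof
    fix n x and a k' :: nat
    assume "k' \<notin> {k}"
    then show "slab k X n x a k' = []" by (simp add: slab_def)
  next
    fix n x and a b :: nat
    assume *: "x \<in> elems X {1..n}" "a \<in> {1..n}" "b \<in> {1..n}" "a \<noteq> b"
    interpret free_symmetric_collection X n using *(2) by (rule X)
    have "orbit_perm x a \<noteq> orbit_perm x b"
      using *(4) permutes_inj[OF orbit_perm(1)[OF *(1)]] by (auto dest: injD)
    then have "slab k X n x a k \<parallel> slab k X n x b k" by (simp add: slab_def parallel_def)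
    then show "apart (slab k X n x a) (slab k X n x b)" unfolding apart_def by blast
  next
    fix n x \<sigma> and a :: nat
    assume *: "x \<in> elems X {1..n}" "\<sigma> permutes {1..n}" "a \<in> {1..n}"
    interpret free_symmetric_collection X n using *(3) by (rule X)
    show "slab k X n (pull X {1..n} {1..n} \<sigma> x) a = slab k X n x (\<sigma> a)"
      using * by (simp add: slab_def orbit_perm_act)
  qed
qed

theorem corollary3p3:
  fixes d :: nat and X :: "nat \<Rightarrow> 'x collection" and n :: nat
  assumes "d \<ge> 1"
    and "\<And>k. 1 \<le> k \<Longrightarrow> k \<le> d \<Longrightarrow> symmetric_collection (X k)"
    and "\<And>k. 1 \<le> k \<Longrightarrow> k \<le> d \<Longrightarrow> free_collection (X k)"
    and "\<And>k. 1 \<le> k \<Longrightarrow> k \<le> d \<Longrightarrow> elems (X k) {} = {} \<and> elems (X k) {1} = {}"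
    and "n \<ge> 1"
  shows "acts_freely (iterated_BV_tensor d (\<lambda>k. free_operad (X k))) n"
proof -
  have "\<exists>h. placement {k} (free_operad (X k)) h" if "1 \<le> k" "k \<le> d" for k
    using slab_vertex_placement[of "X k" k] assms(2,3) that
    by (blast intro: vertex_placement.free_operad_placement(1))
  then obtain h where "placement {1..d} (iterated_BV_tensor d (\<lambda>k. free_operad (X k))) h"
    using iterated_BV_tensor_placement[OF \<open>d \<ge> 1\<close>, of "\<lambda>k. free_operad (X k)"] by blast
  then show ?thesis using \<open>n \<ge> 1\<close> by (rule placement.acts_freely)
qed

end
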